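(* Let $G$ be a connected $r$-regular graph on $p\geq 4$ vertices such that none of the three graphs $F_1,F_2,F_3$ is an induced subgraph of $G$. If the smallest adjacency eigenvalue of $G$ is greater than or equal to $1-r$, then $$E_\epsilon(L(G))=4p(r-1)+4(1-2r).$$
   Context: All graphs are finite, simple, undirected and connected. For a connected graph $H$ with vertices $v_1,\ldots,v_n$, $d(v_i,v_j)$ is the distance and $e(v_i)=\max_j d(v_i,v_j)$ the eccentricity. The eccentricity matrix $\epsilon(H)$ has $(i,j)$ entry $d(v_i,v_j)$ if $d(v_i,v_j)=\min\{e(v_i),e(v_j)\}$ and $0$ otherwise, and the eccentricity energy $E_\epsilon(H)$ is the sum of absolute values of the eigenvalues of $\epsilon(H)$. $L(G)$ is the line graph of $G$. $F_1$ is the path on $5$ vertices; $F_2$ is the graph on vertices $a,b,c,d,e$ with edges $ab,bc,ca,cd,de$ (a triangle with a path of length $2$ attached at one vertex); $F_3$ is the graph on vertices $a,b,c,d,e$ with edges $ab,bc,ca,cd,ce,de$ (two triangles sharing one vertex). *)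

theory Defs
  imports
    "Jordan_Normal_Form.Char_Poly"
    "Graph_Theory.Graph_Theory"
begin

text \<open>
  A finite simple undirected graph is a \<open>pair_graph\<close>, that is, a finite loop-free symmetric
  digraph without parallel arcs; an edge \<open>uv\<close> is the pair of arcs \<open>(u, v)\<close> and \<open>(v, u)\<close>.
\<close>

definition graph_of_edges :: "'a set \<Rightarrow> ('a \<times> 'a) set \<Rightarrow> 'a pair_pre_digraph" where
  "graph_of_edges V E = \<lparr> pverts = V, parcs = E \<union> E\<inverse> \<rparr>"

text \<open>The vertices \<open>a, b, c, d, e\<close> of the three graphs below are \<open>0, 1, 2, 3, 4\<close>.\<close>

definition F1 :: "nat pair_pre_digraph" where
  "F1 = graph_of_edges {0, 1, 2, 3, 4} {(0, 1), (1, 2), (2, 3), (3, 4)}"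

definition F2 :: "nat pair_pre_digraph" where
  "F2 = graph_of_edges {0, 1, 2, 3, 4} {(0, 1), (1, 2), (2, 0), (2, 3), (3, 4)}"

definition F3 :: "nat pair_pre_digraph" where
  "F3 = graph_of_edges {0, 1, 2, 3, 4} {(0, 1), (1, 2), (2, 0), (2, 3), (2, 4), (3, 4)}"

definition has_induced_copy :: "'a pair_pre_digraph \<Rightarrow> 'b pair_pre_digraph \<Rightarrow> bool" where
  "has_induced_copy G F \<longleftrightarrow>
     (\<exists>H. induced_subgraph H (with_proj G) \<and> digraph_iso (with_proj F) H)"

text \<open>By symmetry of the arc relation, the out-degree is the usual degree.\<close>

definition regular :: "nat \<Rightarrow> 'a pair_pre_digraph \<Rightarrow> bool" where
  "regular r G \<longleftrightarrow> (\<forall>v \<in> pverts G. out_degree (with_proj G) v = r)"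

text \<open>The vertices of the line graph are the undirected edges, as two-element vertex sets.\<close>

definition line_graph :: "'a pair_pre_digraph \<Rightarrow> 'a set pair_pre_digraph" where
  "line_graph G =
     (let E = {{u, v} | u v. (u, v) \<in> parcs G}
      in \<lparr> pverts = E, parcs = {(e, f). e \<in> E \<and> f \<in> E \<and> e \<noteq> f \<and> e \<inter> f \<noteq> {}} \<rparr>)"

definition graph_dist :: "'a pair_pre_digraph \<Rightarrow> 'a \<Rightarrow> 'a \<Rightarrow> ereal" where
  "graph_dist G u v = wf_digraph.\<mu> (with_proj G) (\<lambda>_. 1) u v"

definition eccentricity :: "'a pair_pre_digraph \<Rightarrow> 'a \<Rightarrow> ereal" where
  "eccentricity G u = Max (graph_dist G u ` pverts G)"

text \<open>
  Matrices indexed by the vertices need an enumeration of them.  An arbitrary one is fixed;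
  by \<open>char_poly_enumeration_independent\<close> below the spectrum with multiplicities does not
  depend on it.
\<close>

definition vertex_list :: "'a pair_pre_digraph \<Rightarrow> 'a list" where
  "vertex_list G = (SOME vs. distinct vs \<and> set vs = pverts G)"

definition matrix_on :: "'a list \<Rightarrow> ('a \<Rightarrow> 'a \<Rightarrow> 'b) \<Rightarrow> 'b mat" where
  "matrix_on vs f = mat (length vs) (length vs) (\<lambda>(i, j). f (vs ! i) (vs ! j))"

definition adjacency_matrix :: "'a pair_pre_digraph \<Rightarrow> real mat" where
  "adjacency_matrix G =
     matrix_on (vertex_list G) (\<lambda>u v. if (u, v) \<in> parcs G then 1 else 0)"

definition eccentricity_matrix :: "'a pair_pre_digraph \<Rightarrow> real mat" where
  "eccentricity_matrix G =
     matrix_on (vertex_list G)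
       (\<lambda>u v. if graph_dist G u v = min (eccentricity G u) (eccentricity G v)
              then real_of_ereal (graph_dist G u v) else 0)"

text \<open>
  \<open>proots\<close> is the multiset of roots, so eigenvalues count with algebraic multiplicity.
  Passing to the complex numbers ensures that none is missed.
\<close>

definition eccentricity_energy :: "'a pair_pre_digraph \<Rightarrow> real" where
  "eccentricity_energy G =
     (\<Sum>k \<in># proots (char_poly (map_mat complex_of_real (eccentricity_matrix G))). cmod k)"

lemma vertex_list:
  assumes "finite (pverts G)"
  shows "distinct (vertex_list G)" "set (vertex_list G) = pverts G"
proof -
  have "\<exists>vs. distinct vs \<and> set vs = pverts G"
    using finite_distinct_list[OF assms] by blast
  from someI_ex[OF this]
  show "distinct (vertex_list G)" "set (vertex_list G) = pverts G"
    unfolding vertex_list_def by blast+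
qed

lemma char_poly_enumeration_independent:
  fixes f :: "'a \<Rightarrow> 'a \<Rightarrow> 'b :: comm_ring_1"
  assumes vs: "distinct vs" and ws: "distinct ws" and eq: "set vs = set ws"
  shows "char_poly (matrix_on vs f) = char_poly (matrix_on ws f)"
proof -
  define n where "n = length vs"
  have n: "length vs = n" "length ws = n"
    using distinct_card[OF vs] distinct_card[OF ws] eq by (simp_all add: n_def)
  define P :: "'b mat" where "P = mat n n (\<lambda>(i, j). if vs ! i = ws ! j then 1 else 0)"
  define Q :: "'b mat" where "Q = mat n n (\<lambda>(i, j). if ws ! i = vs ! j then 1 else 0)"
  have pick: "(\<Sum>k = 0..<n. if xs ! k = x then g (xs ! k) else 0) = g x"
    if "distinct xs" "length xs = n" "x \<in> set xs" for xs x and g :: "'a \<Rightarrow> 'b"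
  proof -
    have "(\<Sum>k = 0..<n. if xs ! k = x then g (xs ! k) else 0) = (\<Sum>y\<in>set xs. if y = x then g y else 0)"
      using that by (intro sum.reindex_bij_betw[OF bij_betw_nth]) auto
    also have "\<dots> = g x" using that by simp
    finally show ?thesis .
  qed
  have v: "vs ! i \<in> set ws" "vs ! i \<in> set vs" "ws ! i \<in> set vs" "ws ! i \<in> set ws"
    if "i < n" for i
    using that n eq nth_mem[of i vs] nth_mem[of i ws] by auto
  have PQ: "P * Q = 1\<^sub>m n"
  proof (rule eq_matI)
    fix i j assume "i < dim_row (1\<^sub>m n :: 'b mat)" "j < dim_col (1\<^sub>m n :: 'b mat)"
    then have ij: "i < n" "j < n" by auto
    have "(P * Q) $$ (i, j)
        = (\<Sum>k = 0..<n. if ws ! k = vs ! i then (if ws ! k = vs ! j then 1 else 0) else 0)"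
      using ij by (auto simp: P_def Q_def scalar_prod_def intro!: sum.cong)
    also have "\<dots> = (if vs ! i = vs ! j then 1 else 0)"
      by (rule pick[OF ws n(2) v(1)[OF ij(1)]])
    also have "\<dots> = (1\<^sub>m n) $$ (i, j)"
      using ij n vs by (simp add: nth_eq_iff_index_eq)
    finally show "(P * Q) $$ (i, j) = (1\<^sub>m n) $$ (i, j)" .
  qed (auto simp: P_def Q_def)
  have QP: "Q * P = 1\<^sub>m n"
  proof (rule eq_matI)
    fix i j assume "i < dim_row (1\<^sub>m n :: 'b mat)" "j < dim_col (1\<^sub>m n :: 'b mat)"
    then have ij: "i < n" "j < n" by auto
    have "(Q * P) $$ (i, j)
        = (\<Sum>k = 0..<n. if vs ! k = ws ! i then (if vs ! k = ws ! j then 1 else 0) else 0)"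
      using ij by (auto simp: P_def Q_def scalar_prod_def intro!: sum.cong)
    also have "\<dots> = (if ws ! i = ws ! j then 1 else 0)"
      by (rule pick[OF vs n(1) v(3)[OF ij(1)]])
    also have "\<dots> = (1\<^sub>m n) $$ (i, j)"
      using ij n ws by (simp add: nth_eq_iff_index_eq)
    finally show "(Q * P) $$ (i, j) = (1\<^sub>m n) $$ (i, j)" .
  qed (auto simp: P_def Q_def)
  have PB: "P * matrix_on ws f = mat n n (\<lambda>(i, j). f (vs ! i) (ws ! j))"
  proof (rule eq_matI)
    fix i j assume "i < dim_row (mat n n (\<lambda>(i, j). f (vs ! i) (ws ! j)))"
      "j < dim_col (mat n n (\<lambda>(i, j). f (vs ! i) (ws ! j)))"
    then have ij: "i < n" "j < n" by auto
    have "(P * matrix_on ws f) $$ (i, j)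
        = (\<Sum>k = 0..<n. if ws ! k = vs ! i then f (ws ! k) (ws ! j) else 0)"
      using ij n by (auto simp: P_def matrix_on_def scalar_prod_def intro!: sum.cong)
    also have "\<dots> = f (vs ! i) (ws ! j)"
      by (rule pick[OF ws n(2) v(1)[OF ij(1)]])
    finally show "(P * matrix_on ws f) $$ (i, j) = mat n n (\<lambda>(i, j). f (vs ! i) (ws ! j)) $$ (i, j)"
      using ij by simp
  qed (auto simp: P_def matrix_on_def n)
  have "P * matrix_on ws f * Q = matrix_on vs f"
  proof (rule eq_matI)
    fix i j assume "i < dim_row (matrix_on vs f)" "j < dim_col (matrix_on vs f)"
    then have ij: "i < n" "j < n" by (auto simp: matrix_on_def n)
    have "(P * matrix_on ws f * Q) $$ (i, j)
        = (\<Sum>k = 0..<n. if ws ! k = vs ! j then f (vs ! i) (ws ! k) else 0)"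
      unfolding PB using ij by (auto simp: Q_def scalar_prod_def intro!: sum.cong)
    also have "\<dots> = f (vs ! i) (vs ! j)"
      by (rule pick[OF ws n(2) v(1)[OF ij(2)]])
    finally show "(P * matrix_on ws f * Q) $$ (i, j) = matrix_on vs f $$ (i, j)"
      using ij by (simp add: matrix_on_def n)
  qed (auto simp: P_def Q_def matrix_on_def n)
  then have "similar_mat_wit (matrix_on vs f) (matrix_on ws f) P Q"
    using PQ QP by (intro similar_mat_witI[of _ _ n])
      (auto simp: P_def Q_def matrix_on_def n)
  then have "similar_mat (matrix_on vs f) (matrix_on ws f)"
    unfolding similar_mat_def by blast
  then show ?thesis by (rule char_poly_similar)
qed

end

theory Submission
  imports Defs "Jordan_Normal_Form.Schur_Decomposition"
begin

text \<open>
  Forbidding the three graphs makes any two disjoint edges of \<open>G\<close> joined by an edge, and counting edges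
  shows that every edge has one disjoint from it.  So \<open>L(G)\<close> has all eccentricities equal to 2, and with
  the incidence matrix \<open>B\<close> its eccentricity matrix is \<open>2(J + I - B\<^sup>T B)\<close>.  The spectrum of \<open>B\<^sup>T B\<close> agrees
  up to zeros with that of \<open>B B\<^sup>T = A + r I\<close>, and adding \<open>J\<close> only moves the eigenvalue of the all-ones
  vector.  As the eigenvalues of \<open>A\<close> are at least \<open>1 - r\<close>, those of \<open>2 (I - B B\<^sup>T)\<close> are nonpositive, so
  that their absolute values sum to minus the trace.
\<close>

section \<open>Spectra of intertwined matrices\<close>

text \<open>
  Conjugating by a unipotent block matrix moves \<open>Y * C\<close> from one diagonal block to the other.  The case
  \<open>M = 0\<close>, \<open>K = 0\<close> is Sylvester's identity for \<open>Y * C\<close> and \<open>C * Y\<close>; a column \<open>Y\<close> gives a rank-one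
  perturbation along an eigenvector.
\<close>

lemma char_poly_intertwine:
  fixes M Y C K :: "complex mat"
  assumes M: "M \<in> carrier_mat n n" and Y: "Y \<in> carrier_mat n m"
    and C: "C \<in> carrier_mat m n" and K: "K \<in> carrier_mat m m"
    and MY: "M * Y = Y * K"
  shows "char_poly M * char_poly (K + C * Y) = char_poly (M + Y * C) * char_poly K"
proof -
  let ?X = "four_block_mat M (0\<^sub>m n m) C (K + C * Y)"
  let ?X' = "four_block_mat (M + Y * C) (0\<^sub>m n m) C K"
  let ?P = "four_block_mat (1\<^sub>m n) Y (0\<^sub>m m n) (1\<^sub>m m)"
  let ?Q = "four_block_mat (1\<^sub>m n) (- Y) (0\<^sub>m m n) (1\<^sub>m m)"
  \<comment> \<open>The rule for block triangular matrices asks for diagonal blocks whose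
    characteristic polynomials split, which holds over the complex numbers.\<close>
  have lin: "\<exists>as. char_poly A = (\<Prod>a\<leftarrow>as. [:- a, 1:])" if "A \<in> carrier_mat k k"
    for A :: "complex mat" and k
    using char_poly_factorized[OF that] by blast
  have CY: "C * Y \<in> carrier_mat m m" and YC: "Y * C \<in> carrier_mat n n"
    and KCY: "K + C * Y \<in> carrier_mat m m" and MYC: "M + Y * C \<in> carrier_mat n n"
    and nY: "- Y \<in> carrier_mat n m"
    using assms by auto
  have cancel: "Y + - Y = 0\<^sub>m n m" "- Y + Y = 0\<^sub>m n m" "- 0\<^sub>m m m + 1\<^sub>m m = (1\<^sub>m m :: complex mat)"
    using Y by (auto intro: eq_matI)
  have PQ: "?P * ?Q = 1\<^sub>m (n + m)"
    using Y nY by (subst mult_four_block_mat[where ?nr1.0 = n and ?nr2.0 = m and ?n1.0 = n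
        and ?n2.0 = m and ?nc1.0 = n and ?nc2.0 = m]) (auto simp: cancel)
  have QP: "?Q * ?P = 1\<^sub>m (n + m)"
    using Y nY by (subst mult_four_block_mat[where ?nr1.0 = n and ?nr2.0 = m and ?n1.0 = n
        and ?n2.0 = m and ?nc1.0 = n and ?nc2.0 = m]) (auto simp: cancel)
  have PX: "?P * ?X = four_block_mat (M + Y * C) (Y * (K + C * Y)) C (K + C * Y)"
    using assms CY KCY by (subst mult_four_block_mat[where ?nr1.0 = n and ?nr2.0 = m and ?n1.0 = n
        and ?n2.0 = m and ?nc1.0 = n and ?nc2.0 = m]) (auto simp del: assoc_mult_mat)
  \<comment> \<open>The relation \<open>M * Y = Y * K\<close> enters here: it makes the upper right
    block vanish after conjugation.\<close>
  have eq12: "(M + Y * C) * (- Y) + Y * (K + C * Y) = 0\<^sub>m n m"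
  proof -
    have "(M + Y * C) * Y = M * Y + Y * C * Y"
      using M YC Y by (rule add_mult_distrib_mat)
    moreover have "Y * (K + C * Y) = Y * K + Y * (C * Y)"
      using Y K CY by (rule mult_add_distrib_mat)
    moreover have "Y * C * Y = Y * (C * Y)"
      using Y C Y by (rule assoc_mult_mat)
    ultimately have "(M + Y * C) * Y = Y * (K + C * Y)" using MY by simp
    moreover have "(M + Y * C) * (- Y) = - ((M + Y * C) * Y)"
      by (rule uminus_mult_right_mat) (use MYC Y in auto)
    ultimately show ?thesis using Y KCY by simp
  qed
  have eq22: "C * (- Y) + (K + C * Y) = K"
  proof -
    have "C * (- Y) = - (C * Y)" by (rule uminus_mult_right_mat) (use C Y in auto)
    then show ?thesis using K CY by (intro eq_matI) (auto simp del: index_mult_mat)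
  qed
  have PXQ: "?P * ?X * ?Q = ?X'"
    unfolding PX
    by (subst mult_four_block_mat[where ?nr1.0 = n and ?nr2.0 = m and ?n1.0 = n
        and ?n2.0 = m and ?nc1.0 = n and ?nc2.0 = m])
      (use assms CY KCY MYC nY eq12 eq22 in \<open>auto simp del: assoc_mult_mat\<close>)
  have "similar_mat_wit ?X' ?X ?P ?Q"
    by (rule similar_mat_witI[OF PQ QP PXQ[symmetric]]) (use assms KCY MYC nY in simp_all)
  then have "similar_mat ?X' ?X" unfolding similar_mat_def by blast
  then have "char_poly ?X' = char_poly ?X" by (rule char_poly_similar)
  moreover have "char_poly ?X = char_poly M * char_poly (K + C * Y)"
    by (rule char_poly_0_block'[OF refl lin[OF M] lin[OF KCY] M C KCY])
  moreover have "char_poly ?X' = char_poly (M + Y * C) * char_poly K"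
    by (rule char_poly_0_block'[OF refl lin[OF MYC] lin[OF K] MYC C K])
  ultimately show ?thesis by simp
qed

section \<open>Energy as a sum over the spectrum\<close>

text \<open>Stated for arbitrary complex matrices because the intermediate matrices of the argument
  are not eccentricity matrices of graphs.\<close>

definition spectral_energy :: "complex mat \<Rightarrow> real" where
  "spectral_energy M = (\<Sum>k \<in># proots (char_poly M). cmod k)"

lemma char_poly_nonzero:
  fixes M :: "'a :: idom mat"
  assumes "M \<in> carrier_mat n n"
  shows "char_poly M \<noteq> 0"
  using degree_monic_char_poly[OF assms] by (metis coeff_0 zero_neq_one)

text \<open>Characteristic polynomials are nonzero, so \<open>proots\<close> turns the product
  identity into one between multiset sums, and summing moduli makes it additive.\<close>

lemma spectral_energy_intertwine:
  assumes M: "M \<in> carrier_mat n n" and Y: "Y \<in> carrier_mat n m"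
    and C: "C \<in> carrier_mat m n" and K: "K \<in> carrier_mat m m"
    and MY: "M * Y = Y * K"
  shows "spectral_energy M + spectral_energy (K + C * Y)
    = spectral_energy (M + Y * C) + spectral_energy K"
proof -
  have "K + C * Y \<in> carrier_mat m m" "M + Y * C \<in> carrier_mat n n" using assms by auto
  then have "proots (char_poly M) + proots (char_poly (K + C * Y))
    = proots (char_poly (M + Y * C)) + proots (char_poly K)"
    using char_poly_intertwine[OF assms] M K
    by (metis char_poly_nonzero proots_mult)
  then have "image_mset cmod (proots (char_poly M)) + image_mset cmod (proots (char_poly (K + C * Y)))
    = image_mset cmod (proots (char_poly (M + Y * C))) + image_mset cmod (proots (char_poly K))"
    by (metis image_mset_union)
  then show ?thesis unfolding spectral_energy_def by (metis sum_mset.union)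
qed

lemma proots_linear_factors:
  "proots (\<Prod>a\<leftarrow>as. [:- a, 1:]) = mset (as :: 'a :: idom list)"
proof (induction as)
  case (Cons a as)
  have "(\<Prod>a\<leftarrow>as. [:- a, 1:]) \<noteq> 0" by (auto simp: prod_list_zero_iff)
  then show ?case using Cons by (simp add: proots_mult del: mult_pCons_left)
qed auto

lemma proots_char_poly_upper_triangular:
  fixes M :: "'a :: idom mat"
  assumes "M \<in> carrier_mat n n" "upper_triangular M"
  shows "proots (char_poly M) = mset (diag_mat M)"
  by (simp add: char_poly_upper_triangular[OF assms] proots_linear_factors)

lemma spectral_energy_scalar: "spectral_energy (c \<cdot>\<^sub>m 1\<^sub>m n) = real n * cmod c"
proof -
  have "diag_mat (c \<cdot>\<^sub>m 1\<^sub>m n) = replicate n c"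
    by (auto simp: diag_mat_def intro: nth_equalityI)
  moreover have "proots (char_poly (c \<cdot>\<^sub>m 1\<^sub>m n)) = mset (diag_mat (c \<cdot>\<^sub>m 1\<^sub>m n))"
    by (rule proots_char_poly_upper_triangular[of _ n]) (auto simp: upper_triangular_def)
  ultimately show ?thesis by (simp add: spectral_energy_def)
qed

section \<open>Traces and real symmetric matrices\<close>

lemma trace_mult_commute:
  fixes A :: "'a :: comm_ring_1 mat"
  assumes "A \<in> carrier_mat n m" "B \<in> carrier_mat m n"
  shows "sum_list (diag_mat (A * B)) = sum_list (diag_mat (B * A))"
proof -
  have "sum_list (diag_mat (A * B)) = (\<Sum>i<n. \<Sum>j<m. A $$ (i, j) * B $$ (j, i))"
    using assms by (simp add: diag_mat_def interv_sum_list_conv_sum_set_nat scalar_prod_def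
        atLeast0LessThan)
  also have "\<dots> = (\<Sum>j<m. \<Sum>i<n. B $$ (j, i) * A $$ (i, j))"
    by (subst sum.swap) (simp add: mult.commute)
  also have "\<dots> = sum_list (diag_mat (B * A))"
    using assms by (simp add: diag_mat_def interv_sum_list_conv_sum_set_nat scalar_prod_def
        atLeast0LessThan)
  finally show ?thesis .
qed

text \<open>By Schur triangularisation \<open>M\<close> is similar to an upper triangular
  \<open>T\<close>; similarity preserves trace and characteristic polynomial, and the diagonal of
  \<open>T\<close> lists the eigenvalues with multiplicity.\<close>

lemma sum_proots_char_poly:
  fixes M :: "complex mat"
  assumes M: "M \<in> carrier_mat n n"
  shows "\<Sum>\<^sub># (proots (char_poly M)) = sum_list (diag_mat M)"
proof -
  obtain as where as: "char_poly M = (\<Prod>a\<leftarrow>as. [:- a, 1:])"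
    using char_poly_factorized[OF M] by blast
  obtain T where T: "T \<in> carrier_mat n n" "upper_triangular T" "similar_mat M T"
    using schur_decomposition_exists[OF M as] by blast
  from similar_matD[OF T(3)] obtain k P Q where
    PQ: "{M, T, P, Q} \<subseteq> carrier_mat k k" "Q * P = 1\<^sub>m k" "M = P * T * Q" by blast
  then have k: "P \<in> carrier_mat k k" "Q \<in> carrier_mat k k" "T \<in> carrier_mat k k" by auto
  have "sum_list (diag_mat M) = sum_list (diag_mat (Q * (P * T)))"
    unfolding PQ(3) by (rule trace_mult_commute[of _ k k]) (use k in auto)
  also have "Q * (P * T) = T"
    using assoc_mult_mat[OF k(2,1,3)] PQ(2) k(3) by simp
  also have "sum_list (diag_mat T) = \<Sum>\<^sub># (proots (char_poly T))"
    by (simp add: proots_char_poly_upper_triangular[OF T(1,2)] sum_mset_sum_list)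
  also have "char_poly T = char_poly M" using char_poly_similar[OF T(3)] by simp
  finally show ?thesis ..
qed

text \<open>At an eigenvector the Hermitian form of the matrix is \<open>z\<close> times a positive
  number, while symmetry makes it equal to its own conjugate. So \<open>z\<close> is real, and a
  real root of the complexified polynomial is a root of the real one.\<close>

lemma root_char_poly_real_symmetric:
  fixes W :: "real mat"
  assumes W: "W \<in> carrier_mat n n"
    and sym: "\<And>i j. i < n \<Longrightarrow> j < n \<Longrightarrow> W $$ (i, j) = W $$ (j, i)"
    and z: "poly (char_poly (map_mat complex_of_real W)) z = 0"
  obtains k where "z = complex_of_real k" "eigenvalue W k"
proof -
  let ?W = "map_mat complex_of_real W"
  have WC: "?W \<in> carrier_mat n n" using W by simp
  obtain v where v: "v \<in> carrier_vec n" "v \<noteq> 0\<^sub>v n" "?W *\<^sub>v v = z \<cdot>\<^sub>v v"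
    using z W unfolding eigenvalue_root_char_poly[OF WC, symmetric] eigenvalue_def eigenvector_def
    by auto
  \<comment> \<open>\<open>s\<close> is the Hermitian form at \<open>v\<close>, and \<open>t\<close>
    below is the squared norm of \<open>v\<close>.\<close>
  define s where "s = (\<Sum>i<n. \<Sum>j<n. cnj (v $ i) * of_real (W $$ (i, j)) * v $ j)"
  define t where "t = (\<Sum>i<n. (cmod (v $ i))\<^sup>2)"
  have row: "(\<Sum>j<n. of_real (W $$ (i, j)) * v $ j) = z * v $ i" if "i < n" for i
    using arg_cong[OF v(3), of "\<lambda>u. u $ i"] that W v(1)
    by (simp add: scalar_prod_def atLeast0LessThan)
  have "s = (\<Sum>i<n. cnj (v $ i) * (z * v $ i))"
    unfolding s_def by (intro sum.cong refl) (simp add: row[symmetric] sum_distrib_left mult.assoc)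
  also have "\<dots> = z * of_real t"
    unfolding t_def of_real_sum sum_distrib_left
    by (intro sum.cong refl) (simp add: complex_norm_square mult_ac del: of_real_power)
  finally have s: "s = z * of_real t" .
  have "cnj s = (\<Sum>i<n. \<Sum>j<n. v $ i * of_real (W $$ (i, j)) * cnj (v $ j))"
    unfolding s_def by simp
  also have "\<dots> = (\<Sum>j<n. \<Sum>i<n. v $ i * of_real (W $$ (i, j)) * cnj (v $ j))"
    by (rule sum.swap)
  also have "\<dots> = s"
    unfolding s_def by (intro sum.cong refl) (simp add: sym mult_ac)
  finally have "cnj s = s" .
  obtain i where i: "i < n" "v $ i \<noteq> 0" using v(1,2) by fastforce
  have "t > 0" unfolding t_def
    by (rule sum_pos2[of _ i]) (use i in auto)
  then have "cnj z = z" using \<open>cnj s = s\<close> unfolding s by simp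
  then have zk: "z = of_real (Re z)" by (simp add: complex_eq_iff)
  have "poly (map_poly complex_of_real (char_poly W)) (of_real (Re z)) = 0"
    using z zk by (simp add: of_real_hom.char_poly_hom[OF W])
  then have "poly (char_poly W) (Re z) = 0"
    by simp
  then have "eigenvalue W (Re z)" using eigenvalue_root_char_poly[OF W] by blast
  with zk show thesis by (rule that)
qed

text \<open>The spectrum is real and nonpositive, so each modulus is minus the real part, and the
  eigenvalues sum to the trace.\<close>

lemma spectral_energy_nonpos:
  fixes W :: "real mat"
  assumes W: "W \<in> carrier_mat n n"
    and sym: "\<And>i j. i < n \<Longrightarrow> j < n \<Longrightarrow> W $$ (i, j) = W $$ (j, i)"
    and nonpos: "\<And>k. eigenvalue W k \<Longrightarrow> k \<le> 0"
  shows "spectral_energy (map_mat complex_of_real W) = - sum_list (diag_mat W)"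
proof -
  let ?W = "map_mat complex_of_real W"
  let ?R = "proots (char_poly ?W)"
  have WC: "?W \<in> carrier_mat n n" using W by simp
  have "cmod z = - Re z" if "z \<in># ?R" for z
  proof -
    have "poly (char_poly ?W) z = 0"
      using that char_poly_nonzero[OF WC] by simp
    then obtain k where "z = of_real k" "eigenvalue W k"
      using root_char_poly_real_symmetric[OF W sym] by blast
    then show ?thesis using nonpos[of k] by simp
  qed
  then have "spectral_energy ?W = (\<Sum>z\<in>#?R. - Re z)"
    unfolding spectral_energy_def by (intro arg_cong[of _ _ sum_mset] image_mset_cong) auto
  also have "(\<Sum>z\<in>#R. - Re z) = - Re (\<Sum>\<^sub># R)" for R
    by (induction R) auto
  also have "\<Sum>\<^sub># ?R = sum_list (diag_mat ?W)" by (rule sum_proots_char_poly[OF WC])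
  also have "diag_mat ?W = map of_real (diag_mat W)"
    using W by (auto simp: diag_mat_def)
  also have "Re (sum_list (map complex_of_real xs)) = sum_list xs" for xs
    by (induction xs) auto
  finally show ?thesis .
qed

section \<open>The energy computed from an incidence matrix\<close>

text \<open>
  Here \<open>b\<close> is the vertex-edge incidence matrix.  The first use of intertwining replaces \<open>b\<^sup>T b\<close> by
  \<open>b b\<^sup>T\<close>, the second adds the all-twos matrix along the all-ones eigenvector.
\<close>

lemma spectral_energy_incidence:
  fixes b :: "nat \<Rightarrow> nat \<Rightarrow> real" and A :: "real mat" and p n r :: nat
  assumes A: "A \<in> carrier_mat p p" and diag: "\<And>i. i < p \<Longrightarrow> A $$ (i, i) = 0"
    and gram: "\<And>i k. i < p \<Longrightarrow> k < p \<Longrightarrow>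
      (\<Sum>j<n. b i j * b k j) = A $$ (i, k) + (if i = k then real r else 0)"
    and rows: "\<And>i. i < p \<Longrightarrow> (\<Sum>j<n. b i j) = real r"
    and cols: "\<And>j. j < n \<Longrightarrow> (\<Sum>i<p. b i j) = 2"
    and ev: "\<And>k. eigenvalue A k \<Longrightarrow> k \<ge> 1 - real r"
    and r: "r \<ge> 1" and p: "p \<ge> 4"
  shows "spectral_energy (mat n n (\<lambda>(i, j). complex_of_real
      (2 * (1 + (if i = j then 1 else 0) - (\<Sum>k<p. b k i * b k j)))))
    = 4 * real p * (real r - 1) + 4 * (1 - 2 * real r)"
proof -
  \<comment> \<open>Double counting of the incidences gives pr = 2n.\<close>
  have "(\<Sum>i<p. \<Sum>j<n. b i j) = (\<Sum>j<n. \<Sum>i<p. b i j)" by (rule sum.swap)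
  then have pr: "real p * real r = 2 * real n" by (simp add: rows cols)
  \<comment> \<open>By \<open>gram\<close> this is 2I - 2 b b^T, that is, 2(1 - r)I - 2A.\<close>
  define W where "W = mat p p (\<lambda>(i, k). (if i = k then 2 - 2 * real r else 0) - 2 * A $$ (i, k))"
  have W: "W \<in> carrier_mat p p" by (simp add: W_def)
  have sym: "A $$ (i, k) = A $$ (k, i)" if "i < p" "k < p" for i k
    using gram[OF that] gram[OF that(2,1)] by (auto simp: mult.commute split: if_splits)
  \<comment> \<open>Solving k = 2(1 - r) - 2a for the eigenvalue a of \<open>A\<close> shows that a
    \<ge> 1 - r amounts to k \<le> 0.\<close>
  have "k \<le> 0" if "eigenvalue W k" for k
  proof -
    from that W obtain v where v: "v \<in> carrier_vec p" "v \<noteq> 0\<^sub>v p" "W *\<^sub>v v = k \<cdot>\<^sub>v v"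
      unfolding eigenvalue_def eigenvector_def by auto
    have "(\<Sum>j<p. A $$ (i, j) * v $ j) = (2 - 2 * real r - k) / 2 * v $ i" if i: "i < p" for i
    proof -
      have "k * v $ i = (\<Sum>j<p. ((if i = j then 2 - 2 * real r else 0) - 2 * A $$ (i, j)) * v $ j)"
        using arg_cong[OF v(3), of "\<lambda>u. u $ i"] i W v(1)
        by (simp add: scalar_prod_def atLeast0LessThan W_def)
      also have "\<dots> = (\<Sum>j<p. (if i = j then (2 - 2 * real r) * v $ j else 0)
          - 2 * (A $$ (i, j) * v $ j))"
        by (intro sum.cong) (auto simp: algebra_simps)
      also have "\<dots> = (2 - 2 * real r) * v $ i - 2 * (\<Sum>j<p. A $$ (i, j) * v $ j)"
        using i by (simp add: sum_subtractf sum_distrib_left)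
      finally show ?thesis by (simp add: field_simps)
    qed
    then have "A *\<^sub>v v = ((2 - 2 * real r - k) / 2) \<cdot>\<^sub>v v"
      using A v(1) by (intro eq_vecI) (auto simp: scalar_prod_def atLeast0LessThan)
    then have "eigenvalue A ((2 - 2 * real r - k) / 2)"
      unfolding eigenvalue_def eigenvector_def using A v by auto
    from ev[OF this] show ?thesis by (simp add: field_simps)
  qed
  moreover have "sum_list (diag_mat W) = real p * (2 - 2 * real r)"
    using diag by (simp add: W_def diag_mat_def interv_sum_list_conv_sum_set_nat atLeast0LessThan)
  ultimately have eW: "spectral_energy (map_mat complex_of_real W) = real p * (2 * real r - 2)"
    using spectral_energy_nonpos[OF W] sym by (simp add: W_def algebra_simps)

  \<comment> \<open>2I - 2 b^T b, the target matrix without its all-twos summand.\<close>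
  define M where "M = mat n n (\<lambda>(i, j). complex_of_real
    ((if i = j then 2 else 0) - 2 * (\<Sum>k<p. b k i * b k j)))"
  have M: "M \<in> carrier_mat n n" by (simp add: M_def)
  \<comment> \<open>With Y = b^T and C = -2b, intertwining 2I of size n with 2I of size p trades
    \<open>M\<close> for \<open>W\<close>.\<close>
  define Y where "Y = mat n p (\<lambda>(j, i). complex_of_real (b i j))"
  define C where "C = mat p n (\<lambda>(i, j). complex_of_real (- 2 * b i j))"
  have YC: "Y \<in> carrier_mat n p" "C \<in> carrier_mat p n" by (simp_all add: Y_def C_def)
  have "2 \<cdot>\<^sub>m 1\<^sub>m n * Y = Y * (2 \<cdot>\<^sub>m 1\<^sub>m p)"
    using YC by (subst mult_smult_assoc_mat[of _ n n], simp, simp, subst mult_smult_distrib[of _ n p]) auto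
  then have "spectral_energy (2 \<cdot>\<^sub>m 1\<^sub>m n) + spectral_energy (2 \<cdot>\<^sub>m 1\<^sub>m p + C * Y)
    = spectral_energy (2 \<cdot>\<^sub>m 1\<^sub>m n + Y * C) + spectral_energy (2 \<cdot>\<^sub>m 1\<^sub>m p)"
    by (intro spectral_energy_intertwine[OF _ YC]) auto
  moreover have "2 \<cdot>\<^sub>m 1\<^sub>m p + C * Y = map_mat complex_of_real W"
  proof (rule eq_matI)
    fix i k assume "i < dim_row (map_mat complex_of_real W)" "k < dim_col (map_mat complex_of_real W)"
    then have ik: "i < p" "k < p" by (simp_all add: W_def)
    have "(C * Y) $$ (i, k) = complex_of_real (- 2 * (\<Sum>j<n. b i j * b k j))"
      using ik by (simp add: C_def Y_def scalar_prod_def atLeast0LessThan sum_distrib_left mult.assoc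
          sum_negf)
    then show "(2 \<cdot>\<^sub>m 1\<^sub>m p + C * Y) $$ (i, k) = map_mat complex_of_real W $$ (i, k)"
      using ik YC by (simp add: gram W_def)
  qed (auto simp: W_def C_def Y_def)
  moreover have "2 \<cdot>\<^sub>m 1\<^sub>m n + Y * C = M"
    by (intro eq_matI) (auto simp: M_def C_def Y_def scalar_prod_def atLeast0LessThan
        sum_distrib_left sum_negf mult_ac)
  ultimately have eM: "spectral_energy M = 2 * real n + real p * (2 * real r - 2) - 2 * real p"
    by (simp add: spectral_energy_scalar eW)

  \<comment> \<open>The all-ones column \<open>u\<close> is an eigenvector of \<open>M\<close>: b^T
    b has row sums 2r, since each edge has two ends and each end lies on r edges. Then
    \<open>u * w\<close> is the all-twos matrix, and the eigenvalue 2 - 4r is raised by w u =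
    2n.\<close>
  define K where "K = (complex_of_real (2 - 4 * real r)) \<cdot>\<^sub>m 1\<^sub>m 1"
  define u where "u = mat n 1 (\<lambda>_. 1 :: complex)"
  define w where "w = mat 1 n (\<lambda>_. 2 :: complex)"
  have car: "K \<in> carrier_mat 1 1" "u \<in> carrier_mat n 1" "w \<in> carrier_mat 1 n"
    by (simp_all add: K_def u_def w_def)
  have "M * u = u * K"
  proof (rule eq_matI)
    fix i j assume "i < dim_row (u * K)" "j < dim_col (u * K)"
    then have i: "i < n" "j = 0" by (simp_all add: u_def K_def)
    have "(\<Sum>j<n. \<Sum>k<p. b k i * b k j) = (\<Sum>k<p. \<Sum>j<n. b k i * b k j)" by (rule sum.swap)
    also have "\<dots> = (\<Sum>k<p. b k i * real r)" by (simp add: sum_distrib_left[symmetric] rows)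
    also have "\<dots> = 2 * real r" using i by (simp add: sum_distrib_right[symmetric] cols)
    finally have "(\<Sum>j<n. (if i = j then 2 else 0) - 2 * (\<Sum>k<p. b k i * b k j)) = 2 - 4 * real r"
      using i by (simp add: sum_subtractf sum_distrib_left[symmetric])
    moreover have "(M * u) $$ (i, j)
        = complex_of_real (\<Sum>j<n. (if i = j then 2 else 0) - 2 * (\<Sum>k<p. b k i * b k j))"
      unfolding of_real_sum
      using i by (simp add: M_def u_def scalar_prod_def atLeast0LessThan)
    ultimately show "(M * u) $$ (i, j) = (u * K) $$ (i, j)"
      using i by (simp add: u_def K_def scalar_prod_def)
  qed (auto simp: M_def u_def K_def)
  then have "spectral_energy M + spectral_energy (K + w * u)
    = spectral_energy (M + u * w) + spectral_energy K"
    using M car by (intro spectral_energy_intertwine) auto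
  moreover have "K + w * u = complex_of_real (2 - 4 * real r + 2 * real n) \<cdot>\<^sub>m 1\<^sub>m 1"
    by (intro eq_matI) (auto simp: K_def u_def w_def scalar_prod_def)
  moreover have "M + u * w = mat n n (\<lambda>(i, j). complex_of_real
      (2 * (1 + (if i = j then 1 else 0) - (\<Sum>k<p. b k i * b k j))))"
    by (intro eq_matI) (auto simp: M_def u_def w_def scalar_prod_def algebra_simps)
  moreover have "cmod (complex_of_real (2 - 4 * real r)) = 4 * real r - 2"
    using r unfolding norm_of_real by simp
  \<comment> \<open>The sign of the raised eigenvalue comes from 2n = pr \<ge> 4r.\<close>
  moreover have "cmod (complex_of_real (2 - 4 * real r + 2 * real n)) = 2 - 4 * real r + 2 * real n"
  proof -
    have "4 * real r \<le> real p * real r" using p by (intro mult_right_mono) auto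
    then show ?thesis unfolding norm_of_real pr by simp
  qed
  ultimately show ?thesis
    using eM pr by (simp add: spectral_energy_scalar K_def algebra_simps)
qed

section \<open>Forbidden induced subgraphs\<close>

text \<open>Reduces an isomorphism of digraphs to a vertex map: arcs are pairs of vertices, so
  \<open>f\<close> determines the map on arcs, and the induced subgraph on the image of
  \<open>f\<close> is the copy.\<close>

lemma has_induced_copyI:
  assumes F: "pair_wf_digraph F" and G: "pair_wf_digraph G"
    and inj: "inj_on f (pverts F)" and im: "f ` pverts F \<subseteq> pverts G"
    and arcs: "\<And>x y. x \<in> pverts F \<Longrightarrow> y \<in> pverts F \<Longrightarrow> (x, y) \<in> parcs F \<longleftrightarrow> (f x, f y) \<in> parcs G"
  shows "has_induced_copy G F"
proof -
  interpret F: pair_wf_digraph F by (rule F)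
  interpret G: pair_wf_digraph G by (rule G)
  define H where "H = with_proj \<lparr> pverts = f ` pverts F,
    parcs = {a \<in> parcs G. fst a \<in> f ` pverts F \<and> snd a \<in> f ` pverts F} \<rparr>"
  define h where "h = \<lparr> iso_verts = f, iso_arcs = map_prod f f, iso_head = snd, iso_tail = fst \<rparr>"
  have "wf_digraph H" unfolding H_def by unfold_locales auto
  then have "induced_subgraph H (with_proj G)"
    using G.wf_digraph_axioms im
    by (auto simp: H_def subgraph_def compatible_def)
  moreover have "F.digraph_isomorphism h"
  proof -
    have "inj_on (map_prod f f) (parcs F)"
      using map_prod_inj_on[OF inj inj]
      by (rule inj_on_subset) (auto dest: F.in_arcsD1 F.in_arcsD2)
    then show ?thesis
      unfolding F.digraph_isomorphism_def h_def using inj F.wf_digraph_axioms by auto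
  qed
  moreover have "H = app_iso h (with_proj F)"
  proof -
    have "{a \<in> parcs G. fst a \<in> f ` pverts F \<and> snd a \<in> f ` pverts F} = map_prod f f ` parcs F"
    proof (intro equalityI subsetI)
      fix a assume a: "a \<in> {a \<in> parcs G. fst a \<in> f ` pverts F \<and> snd a \<in> f ` pverts F}"
      then obtain x y where xy: "x \<in> pverts F" "y \<in> pverts F" "fst a = f x" "snd a = f y" by blast
      then have "a = map_prod f f (x, y)" by (simp add: prod_eq_iff)
      moreover have "(x, y) \<in> parcs F" using a xy arcs by (metis (no_types, lifting) mem_Collect_eq prod.collapse)
      ultimately show "a \<in> map_prod f f ` parcs F" by blast
    next
      fix a assume "a \<in> map_prod f f ` parcs F"
      then obtain x y where "a = (f x, f y)" "(x, y) \<in> parcs F" by auto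
      moreover from this have "x \<in> pverts F" "y \<in> pverts F" by (auto dest: F.in_arcsD1 F.in_arcsD2)
      ultimately show "a \<in> {a \<in> parcs G. fst a \<in> f ` pverts F \<and> snd a \<in> f ` pverts F}"
        using arcs by simp
    qed
    then show ?thesis by (simp add: H_def app_iso_def h_def with_proj_def)
  qed
  ultimately show ?thesis unfolding has_induced_copy_def digraph_iso_def by blast
qed

lemma pair_graph_graph_of_edges:
  assumes "finite V" "E \<subseteq> V \<times> V" "\<forall>(x, y)\<in>E. x \<noteq> y"
  shows "pair_graph (graph_of_edges V E)"
proof
  have "finite E" using assms(1,2) by (meson finite_SigmaI finite_subset)
  then show "finite (parcs (graph_of_edges V E))" by (simp add: graph_of_edges_def)
  show "symmetric (with_proj (graph_of_edges V E))"
    by (simp add: symmetric_def graph_of_edges_def sym_Un_converse)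
qed (use assms in \<open>auto simp: graph_of_edges_def\<close>)

context pair_graph
begin

lemma arc_sym: "(x, y) \<in> parcs G \<longleftrightarrow> (y, x) \<in> parcs G"
  using arcs_symmetric by blast

lemma arc_irrefl [simp]: "(x, x) \<notin> parcs G"
  using no_loops' by blast

text \<open>Induction along a walk from \<open>x\<close> to \<open>y\<close>. This is the form in
  which connectedness is used throughout.\<close>

lemma connected_closed_set:
  assumes con: "Digraph_Component.connected (with_proj G)"
    and x: "x \<in> pverts G" "x \<in> S" and y: "y \<in> pverts G"
    and closed: "\<And>a b. a \<in> S \<Longrightarrow> (a, b) \<in> parcs G \<Longrightarrow> b \<in> S"
  shows "y \<in> S"
proof -
  have "reachable (with_proj (mk_symmetric (with_proj G))) x y"
    using con x y unfolding connected_def strongly_connected_def by simp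
  then have "reachable (with_proj G) x y"
    using reachable_mk_symmetric_eq[OF sym_arcs] by simp
  then show ?thesis
    by (induction rule: reachable_induct) (use x closed in auto)
qed

text \<open>Ten pairs i < j suffice: symmetry of the arcs covers i > j, and absence of loops covers
  i = j.\<close>

lemma induced_copy_of_five:
  assumes F: "pair_graph F" "pverts F = {0, 1, 2, 3, 4}"
    and V: "set xs \<subseteq> pverts G" "distinct xs" "length xs = 5"
    and arcs: "\<forall>(i, j)\<in>{(0, 1), (0, 2), (0, 3), (0, 4), (1, 2), (1, 3), (1, 4), (2, 3), (2, 4), (3, 4)}.
      (i, j) \<in> parcs F \<longleftrightarrow> (xs ! i, xs ! j) \<in> parcs G"
  shows "has_induced_copy G F"
proof (rule has_induced_copyI[of F G "(!) xs"])
  interpret F: pair_graph F by (rule F(1))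
  have *: "pverts F = {..<5}" using F(2) by auto
  show "inj_on ((!) xs) (pverts F)" unfolding * using V by (intro inj_on_nth) auto
  show "(!) xs ` pverts F \<subseteq> pverts G" unfolding * using V by auto
  have less: "(i, j) \<in> parcs F \<longleftrightarrow> (xs ! i, xs ! j) \<in> parcs G" if "i < j" "j < 5" for i j
  proof -
    have "j = 1 \<or> j = 2 \<or> j = 3 \<or> j = 4" using that by linarith
    moreover have "i = 0 \<or> i = 1 \<or> i = 2 \<or> i = 3" using that by linarith
    ultimately show ?thesis using arcs \<open>i < j\<close> by (elim disjE) simp_all
  qed
  show "(i, j) \<in> parcs F \<longleftrightarrow> (xs ! i, xs ! j) \<in> parcs G" if "i \<in> pverts F" "j \<in> pverts F" for i j
  proof (cases i j rule: linorder_cases)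
    case greater
    then show ?thesis
      using less[of j i] that F.arc_sym[of i j] arc_sym[of "xs ! i" "xs ! j"] by (simp add: *)
  qed (use that less[of i j] in \<open>simp_all add: *\<close>)
  show "pair_wf_digraph F" "pair_wf_digraph G" by unfold_locales
qed

text \<open>The hypotheses decide eight of the ten pairs. Of the remaining pairs ac and ce, none
  being an edge gives \<open>F1\<close>, exactly one gives \<open>F2\<close>, and both give
  \<open>F3\<close>.\<close>

lemma induced_copies_of_five:
  assumes V: "{a, b, c, d, e} \<subseteq> pverts G" "distinct [a, b, c, d, e]"
    and arcs: "(a, b) \<in> parcs G" "(b, c) \<in> parcs G" "(c, d) \<in> parcs G" "(d, e) \<in> parcs G"
      "(a, d) \<notin> parcs G" "(a, e) \<notin> parcs G" "(b, d) \<notin> parcs G" "(b, e) \<notin> parcs G"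
  shows "has_induced_copy G F1 \<or> has_induced_copy G F2 \<or> has_induced_copy G F3"
proof -
  have F: "pair_graph F1" "pair_graph F2" "pair_graph F3"
    by (simp_all add: F1_def F2_def F3_def pair_graph_graph_of_edges)
  consider "(a, c) \<notin> parcs G" "(c, e) \<notin> parcs G" | "(a, c) \<in> parcs G" "(c, e) \<notin> parcs G"
    | "(a, c) \<notin> parcs G" "(c, e) \<in> parcs G" | "(a, c) \<in> parcs G" "(c, e) \<in> parcs G" by blast
  then show ?thesis
  proof cases
    case 1
    then have "has_induced_copy G F1"
      by (intro induced_copy_of_five[OF F(1), of "[a, b, c, d, e]"])
        (use V arcs in \<open>simp_all add: F1_def graph_of_edges_def\<close>)
    then show ?thesis by blast
  next
    case 2
    then have "has_induced_copy G F2"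
      by (intro induced_copy_of_five[OF F(2), of "[a, b, c, d, e]"])
        (use V arcs in \<open>simp_all add: F2_def graph_of_edges_def\<close>)
    then show ?thesis by blast
  next
    case 3
    \<comment> \<open>The mirror image of the previous case: the vertices are read backwards, so the
      triangle again comes first.\<close>
    then have "(e, d) \<in> parcs G" "(d, c) \<in> parcs G" "(c, b) \<in> parcs G" "(b, a) \<in> parcs G"
      "(e, b) \<notin> parcs G" "(e, a) \<notin> parcs G" "(d, b) \<notin> parcs G" "(d, a) \<notin> parcs G"
      "(e, c) \<in> parcs G" "(c, a) \<notin> parcs G"
      using arcs by (simp_all add: arc_sym[of e d] arc_sym[of d c] arc_sym[of c b] arc_sym[of b a]
          arc_sym[of e b] arc_sym[of e a] arc_sym[of d b] arc_sym[of d a] arc_sym[of e c] arc_sym[of c a])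
    then have "has_induced_copy G F2"
      by (intro induced_copy_of_five[OF F(2), of "[e, d, c, b, a]"])
        (use V in \<open>auto simp: F2_def graph_of_edges_def\<close>)
    then show ?thesis by blast
  next
    case 4
    then have "has_induced_copy G F3"
      by (intro induced_copy_of_five[OF F(3), of "[a, b, c, d, e]"])
        (use V arcs in \<open>simp_all add: F3_def graph_of_edges_def\<close>)
    then show ?thesis by blast
  qed
qed

text \<open>If \<open>xy\<close> were not joined to \<open>uv\<close>, it would avoid the closed
  neighbourhood \<open>D\<close> of \<open>uv\<close>. The ends of edges avoiding \<open>D\<close>
  form a set closed under adjacency, because an edge from it into \<open>D\<close> would complete a
  forbidden five-vertex subgraph. Connectedness would then put \<open>u\<close> itself outside
  \<open>D\<close>.\<close>

lemma disjoint_arcs_joined: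
  assumes con: "Digraph_Component.connected (with_proj G)"
    and F1: "\<not> has_induced_copy G F1" and F2: "\<not> has_induced_copy G F2"
    and F3: "\<not> has_induced_copy G F3"
    and uv: "(u, v) \<in> parcs G" and xy: "(x, y) \<in> parcs G" and disj: "{u, v} \<inter> {x, y} = {}"
  shows "\<exists>a\<in>{u, v}. \<exists>b\<in>{x, y}. (a, b) \<in> parcs G"
proof (rule ccontr)
  assume no: "\<not> ?thesis"
  define D where "D = {u, v} \<union> {w. (u, w) \<in> parcs G \<or> (v, w) \<in> parcs G}"
  \<comment> \<open>By connectedness, some vertex of \<open>S\<close> has a neighbour in \<open>D\<close>; the five vertices around it contradict the hypotheses.\<close>
  define S where "S = {x. x \<notin> D \<and> (\<exists>y. y \<notin> D \<and> (x, y) \<in> parcs G)}"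
  have no_nbr: "w \<notin> D" if "x \<in> S" "(x, w) \<in> parcs G" for x w
  proof
    assume w: "w \<in> D"
    obtain y where y: "x \<notin> D" "y \<notin> D" "(x, y) \<in> parcs G" using \<open>x \<in> S\<close> by (auto simp: S_def)
    have arcs: "(u, v) \<in> parcs G" "(v, u) \<in> parcs G" "(x, y) \<in> parcs G" "(w, x) \<in> parcs G"
      "(u, x) \<notin> parcs G" "(u, y) \<notin> parcs G" "(v, x) \<notin> parcs G" "(v, y) \<notin> parcs G"
      using uv y that(2) arc_sym[of u v] arc_sym[of x w] by (simp_all add: D_def)
    have uw: "w \<noteq> u" "w \<noteq> v" using arcs by auto
    then have w_nbr: "(u, w) \<in> parcs G \<or> (v, w) \<in> parcs G" using w by (auto simp: D_def)
    \<comment> \<open>One ordering for \<open>w\<close> adjacent to \<open>u\<close>, one for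
      \<open>w\<close> adjacent to \<open>v\<close>: in each, the path enters \<open>w\<close> from
      its neighbour on the edge \<open>uv\<close> and continues to \<open>x\<close> and
      \<open>y\<close>.\<close>
    have dist: "distinct [v, u, w, x, y]" "distinct [u, v, w, x, y]"
      using arcs uw y w by (auto simp: D_def)
    have V: "{v, u, w, x, y} \<subseteq> pverts G" "{u, v, w, x, y} \<subseteq> pverts G"
      using arcs by (auto dest: in_arcsD1 in_arcsD2)
    from w_nbr show False
      using induced_copies_of_five[OF V(1) dist(1)] induced_copies_of_five[OF V(2) dist(2)]
        arcs F1 F2 F3 by blast
  qed
  have "x \<in> S"
    using no xy disj by (auto simp: S_def D_def)
  \<comment> \<open>Here \<open>a\<close> itself serves as the neighbour of \<open>b\<close> outside
    \<open>D\<close>.\<close>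
  moreover have "b \<in> S" if "a \<in> S" "(a, b) \<in> parcs G" for a b
    using no_nbr[OF that] that arc_sym[of a b] by (auto simp: S_def)
  ultimately have "u \<in> S"
    using connected_closed_set[OF con, of x S u] uv xy by (auto dest: in_arcsD1)
  then show False by (simp add: S_def D_def)
qed

end

section \<open>Graph distance from walk lengths\<close>

lemma graph_dist_le:
  assumes "pair_wf_digraph G" "pre_digraph.awalk (with_proj G) u p v"
  shows "graph_dist G u v \<le> ereal (real (length p))"
proof -
  interpret pair_wf_digraph G by fact
  have "awalk_cost (\<lambda>_. 1) p = real (length p)" by (induction p) auto
  then show ?thesis
    using min_cost_le_walk_cost[OF assms(2), of "\<lambda>_. 1"] by (simp add: graph_dist_def)
qed

lemma graph_dist_ge:
  assumes "pair_wf_digraph G"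
    and "\<And>p. pre_digraph.awalk (with_proj G) u p v \<Longrightarrow> k \<le> length p"
  shows "ereal (real k) \<le> graph_dist G u v"
proof -
  interpret pair_wf_digraph G by fact
  have "awalk_cost (\<lambda>_. 1) p = real (length p)" for p by (induction p) auto
  then show ?thesis
    using assms(2) unfolding graph_dist_def \<mu>_def by (intro INF_greatest) auto
qed

text \<open>The distance is an infimum over walks, so each value takes an explicit walk for the
  upper bound and the exclusion of shorter walks for the lower one.\<close>

lemma graph_dist_diameter_2:
  assumes wf: "pair_wf_digraph G" and u: "u \<in> pverts G"
    and nbr: "u \<noteq> v \<Longrightarrow> (u, v) \<notin> parcs G \<Longrightarrow> \<exists>w. (u, w) \<in> parcs G \<and> (w, v) \<in> parcs G"
  shows "graph_dist G u v = (if u = v then 0 else if (u, v) \<in> parcs G then 1 else 2)"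
proof -
  interpret pair_wf_digraph G by fact
  consider "u = v" | "u \<noteq> v" "(u, v) \<in> parcs G" | w where "u \<noteq> v" "(u, v) \<notin> parcs G"
    "(u, w) \<in> parcs G" "(w, v) \<in> parcs G"
    using nbr by blast
  then show ?thesis
  proof cases
    case 1
    then show ?thesis
      using graph_dist_le[OF wf, of u "[]" u] graph_dist_ge[OF wf, of u u 0] u
      by (auto simp: awalk_Nil_iff zero_ereal_def intro: antisym)
  next
    case 2
    have "1 \<le> length p" if "awalk u p v" for p
      using that 2 by (cases p) (auto simp: awalk_Nil_iff)
    moreover have "awalk u [(u, v)] v" using 2 by (auto simp: awalk_Cons_iff awalk_Nil_iff wellformed')
    ultimately show ?thesis
      using graph_dist_le[OF wf, of u "[(u, v)]" v] graph_dist_ge[OF wf, of u v 1] 2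
      by (auto simp: one_ereal_def intro: antisym)
  next
    case 3
    have "2 \<le> length p" if "awalk u p v" for p
      using that 3 by (cases p; cases "tl p") (auto simp: awalk_Nil_iff awalk_Cons_iff)
    moreover have "awalk u [(u, w), (w, v)] v"
      using 3 by (auto simp: awalk_Cons_iff awalk_Nil_iff wellformed')
    ultimately show ?thesis
      using graph_dist_le[OF wf, of u "[(u, w), (w, v)]" v] graph_dist_ge[OF wf, of u v 2] 3
      by (auto intro: antisym)
  qed
qed

section \<open>The eccentricity matrix of the line graph\<close>

lemma sum_nth:
  assumes "distinct xs"
  shows "(\<Sum>i<length xs. f (xs ! i)) = sum f (set xs)"
  using sum.reindex_bij_betw[OF bij_betw_nth[OF assms refl refl], of f] by simp

context pair_graph
begin

lemma line_graph_verts: "pverts (line_graph G) = (\<lambda>(u, v). {u, v}) ` parcs G"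
  by (auto simp: line_graph_def Let_def)

lemma line_graph_arcs:
  "(e, f) \<in> parcs (line_graph G) \<longleftrightarrow>
    e \<in> pverts (line_graph G) \<and> f \<in> pverts (line_graph G) \<and> e \<noteq> f \<and> e \<inter> f \<noteq> {}"
  by (auto simp: line_graph_def Let_def)

lemma finite_line_graph_verts: "finite (pverts (line_graph G))"
  by (simp add: line_graph_verts)

lemma wf_line_graph: "pair_wf_digraph (line_graph G)"
  by unfold_locales (auto simp: line_graph_arcs)

lemma edge_cases:
  assumes "e \<in> pverts (line_graph G)"
  obtains u v where "e = {u, v}" "(u, v) \<in> parcs G" "u \<noteq> v" "u \<in> pverts G" "v \<in> pverts G"
  using assms by (auto simp: line_graph_verts dest: in_arcsD1 in_arcsD2 no_loops')

lemma edge_iff_arc: "{u, v} \<in> pverts (line_graph G) \<longleftrightarrow> (u, v) \<in> parcs G"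
  using arc_sym by (auto simp: line_graph_verts doubleton_eq_iff image_iff)

section \<open>Counting edges in a regular graph\<close>

text \<open>Each edge at \<open>v\<close> comes from exactly one arc leaving \<open>v\<close>, so
  this number is the out-degree.\<close>

lemma card_edges_at:
  assumes "regular r G" "v \<in> pverts G"
  shows "card {e \<in> pverts (line_graph G). v \<in> e} = r"
proof -
  have "bij_betw (\<lambda>(u, w). {u, w}) (out_arcs (with_proj G) v) {e \<in> pverts (line_graph G). v \<in> e}"
  proof (rule bij_betwI')
    fix e assume "e \<in> {e \<in> pverts (line_graph G). v \<in> e}"
    then obtain u w where "e = {u, w}" "(u, w) \<in> parcs G" "v = u \<or> v = w"
      by (auto simp: line_graph_verts)
    then show "\<exists>a\<in>out_arcs (with_proj G) v. e = (\<lambda>(u, w). {u, w}) a"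
      using arc_sym[of u w] by (auto simp: out_arcs_def)
  qed (auto simp: out_arcs_def line_graph_verts doubleton_eq_iff)
  then show ?thesis
    using assms bij_betw_same_card unfolding regular_def out_degree_def by fastforce
qed

text \<open>Provides the off-diagonal entries of b b^T for the incidence matrix b.\<close>

lemma edges_at_two:
  assumes "u \<noteq> v"
  shows "{e \<in> pverts (line_graph G). u \<in> e \<and> v \<in> e} = (if (u, v) \<in> parcs G then {{u, v}} else {})"
proof -
  have "e = {u, v}" if "e \<in> pverts (line_graph G)" "u \<in> e" "v \<in> e" for e
    using that assms by (auto elim!: edge_cases)
  then show ?thesis using edge_iff_arc by auto
qed

text \<open>Double counting of vertex-edge incidences.\<close>

lemma handshake:
  assumes "regular r G"
  shows "card (pverts G) * r = 2 * card (pverts (line_graph G))"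
proof -
  let ?E = "pverts (line_graph G)"
  have "(\<Sum>v\<in>pverts G. card {e \<in> ?E. v \<in> e}) = (\<Sum>v\<in>pverts G. \<Sum>e\<in>?E. if v \<in> e then 1 else 0)"
    using finite_line_graph_verts by (simp add: sum.inter_filter[symmetric])
  also have "\<dots> = (\<Sum>e\<in>?E. \<Sum>v\<in>pverts G. if v \<in> e then 1 else 0)" by (rule sum.swap)
  also have "\<dots> = (\<Sum>e\<in>?E. card {v \<in> pverts G. v \<in> e})"
    using pair_finite_verts by (simp add: sum.inter_filter[symmetric])
  finally have "(\<Sum>v\<in>pverts G. card {e \<in> ?E. v \<in> e}) = (\<Sum>e\<in>?E. card {v \<in> pverts G. v \<in> e})" .
  moreover have "card {v \<in> pverts G. v \<in> e} = 2" if e: "e \<in> ?E" for e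
  proof -
    obtain u v where "e = {u, v}" "u \<noteq> v" "u \<in> pverts G" "v \<in> pverts G"
      using e by (rule edge_cases)
    then have "{v \<in> pverts G. v \<in> e} = {u, v}" by auto
    with \<open>u \<noteq> v\<close> show ?thesis by simp
  qed
  ultimately show ?thesis using card_edges_at[OF assms] by simp
qed

text \<open>If every edge met \<open>e = {u, v}\<close>, the r edges at \<open>u\<close> and the r
  edges at \<open>v\<close> would be all edges; they share \<open>e\<close>, so there would be fewer
  than 2r. But twice the number of edges is pr \<ge> 4r.\<close>

lemma disjoint_edge_exists:
  assumes reg: "regular r G" and p: "card (pverts G) \<ge> 4" and e: "e \<in> pverts (line_graph G)"
  shows "\<exists>f\<in>pverts (line_graph G). e \<inter> f = {}"
proof (rule ccontr)
  assume no: "\<not> ?thesis"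
  let ?E = "pverts (line_graph G)"
  obtain u v where uv: "e = {u, v}" "u \<in> pverts G" "v \<in> pverts G" using e by (rule edge_cases)
  let ?U = "{e \<in> ?E. u \<in> e}" and ?V = "{e \<in> ?E. v \<in> e}"
  have fin: "finite ?U" "finite ?V" using finite_line_graph_verts by auto
  have "?U \<union> ?V = ?E" using no uv by auto
  moreover have "card (?U \<inter> ?V) > 0" using e uv fin by (auto simp: card_gt_0_iff)
  ultimately have "card ?E < 2 * r"
    using card_Un_Int[OF fin] card_edges_at[OF reg] uv by simp
  moreover have "4 * r \<le> card (pverts G) * r" using p by simp
  ultimately show False using handshake[OF reg] by simp
qed

text \<open>Degree 0 would leave no arcs, so a single vertex would already be closed under
  adjacency.\<close>

lemma regular_degree_pos:
  assumes con: "Digraph_Component.connected (with_proj G)" and reg: "regular r G"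
    and p: "card (pverts G) \<ge> 2"
  shows "r \<ge> 1"
proof (rule ccontr)
  assume "\<not> r \<ge> 1"
  then have "r = 0" by simp
  then have "pverts (line_graph G) = {}"
    using handshake[OF reg] finite_line_graph_verts by simp
  then have "parcs G = {}" by (simp add: line_graph_verts)
  obtain x where x: "x \<in> pverts G" using p by fastforce
  have "y \<in> {x}" if "y \<in> pverts G" for y
    using connected_closed_set[OF con x, of "{x}" y] that \<open>parcs G = {}\<close> by simp
  then have "pverts G \<subseteq> {x}" by auto
  from card_mono[OF _ this] p show False by simp
qed

section \<open>Distances and eccentricities in the line graph\<close>

text \<open>An edge of \<open>G\<close> joining disjoint edges \<open>e\<close> and \<open>f\<close>
  is a common neighbour of them in the line graph.\<close>

lemma graph_dist_line_graph:
  assumes joined: "\<And>u v x y. (u, v) \<in> parcs G \<Longrightarrow> (x, y) \<in> parcs G \<Longrightarrow> {u, v} \<inter> {x, y} = {} \<Longrightarrow>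
      \<exists>a\<in>{u, v}. \<exists>b\<in>{x, y}. (a, b) \<in> parcs G"
    and e: "e \<in> pverts (line_graph G)" and f: "f \<in> pverts (line_graph G)"
  shows "graph_dist (line_graph G) e f = (if e = f then 0 else if e \<inter> f \<noteq> {} then 1 else 2)"
proof -
  have "\<exists>g. (e, g) \<in> parcs (line_graph G) \<and> (g, f) \<in> parcs (line_graph G)"
    if "(e, f) \<notin> parcs (line_graph G)" "e \<noteq> f"
  proof -
    have disj: "e \<inter> f = {}" using that e f by (simp add: line_graph_arcs)
    obtain u v where uv: "e = {u, v}" "(u, v) \<in> parcs G" using e by (rule edge_cases)
    obtain x y where xy: "f = {x, y}" "(x, y) \<in> parcs G" using f by (rule edge_cases)
    obtain a b where ab: "a \<in> e" "b \<in> f" "(a, b) \<in> parcs G"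
      using joined[OF uv(2) xy(2)] disj uv xy by blast
    then have "{a, b} \<in> pverts (line_graph G)" by (simp add: edge_iff_arc)
    moreover have "{a, b} \<noteq> e" "{a, b} \<noteq> f" "e \<inter> {a, b} \<noteq> {}" "{a, b} \<inter> f \<noteq> {}"
      using ab disj by auto
    ultimately show ?thesis using e f unfolding line_graph_arcs by metis
  qed
  then show ?thesis
    using graph_dist_diameter_2[OF wf_line_graph e, of f] e f by (auto simp: line_graph_arcs)
qed

text \<open>All distances are at most 2, and an edge disjoint from \<open>e\<close> attains
  2.\<close>

lemma eccentricity_line_graph:
  assumes joined: "\<And>u v x y. (u, v) \<in> parcs G \<Longrightarrow> (x, y) \<in> parcs G \<Longrightarrow> {u, v} \<inter> {x, y} = {} \<Longrightarrow>
      \<exists>a\<in>{u, v}. \<exists>b\<in>{x, y}. (a, b) \<in> parcs G"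
    and reg: "regular r G" and p: "card (pverts G) \<ge> 4" and e: "e \<in> pverts (line_graph G)"
  shows "eccentricity (line_graph G) e = 2"
  unfolding eccentricity_def
proof (rule Max_eqI)
  obtain f where f: "f \<in> pverts (line_graph G)" "e \<inter> f = {}"
    using disjoint_edge_exists[OF reg p e] by blast
  moreover have "e \<noteq> f" using f e by (auto elim: edge_cases)
  ultimately have "graph_dist (line_graph G) e f = 2"
    using graph_dist_line_graph[OF joined e] by simp
  then show "2 \<in> graph_dist (line_graph G) e ` pverts (line_graph G)"
    using f by force
  have "(1 :: ereal) \<le> 2" by (metis ereal_less_eq(3) numeral_eq_ereal one_ereal_def one_le_numeral)
  then show "d \<le> 2" if "d \<in> graph_dist (line_graph G) e ` pverts (line_graph G)" for d
    using that graph_dist_line_graph[OF joined e] by auto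
qed (simp add: finite_line_graph_verts)

end

theorem theorem3p22:
  fixes G :: "'a pair_pre_digraph" and p r :: nat
  assumes "pair_graph G"
    and "Digraph_Component.connected (with_proj G)"
    and "regular r G"
    and "card (pverts G) = p"
    and "p \<ge> 4"
    and "\<not> has_induced_copy G F1"
    and "\<not> has_induced_copy G F2"
    and "\<not> has_induced_copy G F3"
    and "Min {k. eigenvalue (adjacency_matrix G) k} \<ge> 1 - real r"
  shows "eccentricity_energy (line_graph G) = 4 * real p * (real r - 1) + 4 * (1 - 2 * real r)"
proof -
  interpret pair_graph G by fact
  let ?L = "line_graph G" and ?A = "adjacency_matrix G"
  define vs where "vs = vertex_list G"
  define es where "es = vertex_list ?L"
  define n where "n = length es"
  have vs: "distinct vs" "set vs = pverts G"
    using vertex_list[OF pair_finite_verts] by (simp_all add: vs_def)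
  have es: "distinct es" "set es = pverts ?L"
    using vertex_list[OF finite_line_graph_verts] by (simp_all add: es_def)
  have len: "length vs = p" using assms(4) distinct_card[OF vs(1)] vs(2) by simp
  have vs_in: "vs ! i \<in> pverts G" if "i < p" for i using that vs len nth_mem by blast
  have es_in: "es ! j \<in> pverts ?L" if "j < n" for j using that es n_def nth_mem by blast
  note joined = disjoint_arcs_joined[OF assms(2,6,7,8)]
  \<comment> \<open>The vertex-edge incidence matrix in the enumerations that underlie the two graph
    matrices.\<close>
  define b where "b i j = (if vs ! i \<in> es ! j then 1 else 0 :: real)" for i j

  have sum_edges: "(\<Sum>j<n. if P (es ! j) then 1 else 0) = real (card {e \<in> pverts ?L. P e})" for P
    using sum_nth[OF es(1), of "\<lambda>e. if P e then 1 else 0 :: real"] es finite_line_graph_verts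
    by (simp add: n_def sum.inter_filter[symmetric])
  have sum_verts: "(\<Sum>i<p. if P (vs ! i) then 1 else 0) = real (card {v \<in> pverts G. P v})" for P
    using sum_nth[OF vs(1), of "\<lambda>e. if P e then 1 else 0 :: real"] vs pair_finite_verts len
    by (simp add: sum.inter_filter[symmetric])

  have A: "?A \<in> carrier_mat p p"
    by (simp add: adjacency_matrix_def matrix_on_def vs_def[symmetric] len)
  have Aij: "?A $$ (i, k) = (if (vs ! i, vs ! k) \<in> parcs G then 1 else 0)" if "i < p" "k < p" for i k
    using that by (simp add: adjacency_matrix_def matrix_on_def vs_def[symmetric] len)
  \<comment> \<open>Entries of b b^T count the edges containing both vertices: r on the diagonal,
    adjacency off it.\<close>
  have gram: "(\<Sum>j<n. b i j * b k j) = ?A $$ (i, k) + (if i = k then real r else 0)"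
    if "i < p" "k < p" for i k
  proof -
    have "(\<Sum>j<n. b i j * b k j) = (\<Sum>j<n. if vs ! i \<in> es ! j \<and> vs ! k \<in> es ! j then 1 else 0)"
      by (intro sum.cong) (auto simp: b_def)
    also have "\<dots> = real (card {e \<in> pverts ?L. vs ! i \<in> e \<and> vs ! k \<in> e})"
      by (rule sum_edges)
    finally show ?thesis
      using that vs len vs_in
      by (cases "i = k") (simp_all add: Aij card_edges_at[OF assms(3)] edges_at_two nth_eq_iff_index_eq)
  qed
  have rows: "(\<Sum>j<n. b i j) = real r" if "i < p" for i
    unfolding b_def sum_edges using card_edges_at[OF assms(3) vs_in[OF that]] by simp
  \<comment> \<open>Entries of b^T b count the common ends of two edges.\<close>
  have inter: "(\<Sum>i<p. b i j * b i l) = real (card (es ! j \<inter> es ! l))" if "j < n" "l < n" for j l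
  proof -
    have "(\<Sum>i<p. b i j * b i l) = (\<Sum>i<p. if vs ! i \<in> es ! j \<inter> es ! l then 1 else 0)"
      by (intro sum.cong) (auto simp: b_def)
    also have "\<dots> = real (card {v \<in> pverts G. v \<in> es ! j \<inter> es ! l})"
      by (rule sum_verts)
    also have "{v \<in> pverts G. v \<in> es ! j \<inter> es ! l} = es ! j \<inter> es ! l"
      using es_in[OF that(1)] by (auto elim!: edge_cases)
    finally show ?thesis .
  qed
  have card_edge: "card e = 2" if "e \<in> pverts ?L" for e
    using that by (auto elim!: edge_cases)
  have cols: "(\<Sum>i<p. b i j) = 2" if "j < n" for j
  proof -
    have "(\<Sum>i<p. b i j) = (\<Sum>i<p. b i j * b i j)" by (intro sum.cong) (auto simp: b_def)
    then show ?thesis using inter[OF that that] card_edge[OF es_in[OF that]] by simp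
  qed
  have ev: "k \<ge> 1 - real r" if "eigenvalue ?A k" for k
  proof -
    \<comment> \<open>Finiteness of the spectrum makes \<open>Min\<close> a genuine lower bound for
      every eigenvalue.\<close>
    have "{k. eigenvalue ?A k} = {k. poly (char_poly ?A) k = 0}"
      by (simp add: eigenvalue_root_char_poly[OF A])
    then have "finite {k. eigenvalue ?A k}"
      using poly_roots_finite[OF char_poly_nonzero[OF A]] by simp
    then have "Min {k. eigenvalue ?A k} \<le> k" using that by (intro Min_le) auto
    then show ?thesis using assms(9) by linarith
  qed
  have r: "r \<ge> 1" using regular_degree_pos[OF assms(2,3)] assms(4,5) by simp

  \<comment> \<open>All eccentricities are 2, so the entry is 2 for disjoint edges and 0 otherwise.
    The formula on the right agrees, since the intersection has 2, 1 or 0 elements for equal,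
    distinct meeting and disjoint edges.\<close>
  have "map_mat complex_of_real (eccentricity_matrix ?L) = mat n n (\<lambda>(i, j). complex_of_real
      (2 * (1 + (if i = j then 1 else 0) - (\<Sum>k<p. b k i * b k j))))" (is "?E = ?M")
  proof (rule eq_matI)
    fix i j assume "i < dim_row ?M" "j < dim_col ?M"
    then have ij: "i < n" "j < n" by simp_all
    let ?e = "es ! i" and ?f = "es ! j"
    have e: "?e \<in> pverts ?L" and f: "?f \<in> pverts ?L" using es_in ij by auto
    have meet: "card (?e \<inter> ?f) = (if i = j then 2 else if ?e \<inter> ?f \<noteq> {} then 1 else 0)"
    proof (cases "i = j")
      case False
      then have "?e \<noteq> ?f" using ij es n_def by (simp add: nth_eq_iff_index_eq)
      then show ?thesis using e f False by (auto elim!: edge_cases simp: Int_insert_left)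
    qed (use card_edge[OF e] in simp)
    have neq: "?e = ?f \<longleftrightarrow> i = j" using ij es n_def by (simp add: nth_eq_iff_index_eq)
    have "?e \<noteq> {}" using card_edge[OF e] by auto
    then have "(if graph_dist ?L ?e ?f = min (eccentricity ?L ?e) (eccentricity ?L ?f)
        then real_of_ereal (graph_dist ?L ?e ?f) else 0)
      = 2 * (1 + (if i = j then 1 else 0) - real (card (?e \<inter> ?f)))"
      using eccentricity_line_graph[OF joined assms(3)] assms(4,5) e f meet neq
      by (simp add: graph_dist_line_graph[OF joined e f] one_ereal_def zero_ereal_def)
    then show "?E $$ (i, j) = ?M $$ (i, j)"
      using ij by (simp add: eccentricity_matrix_def matrix_on_def es_def[symmetric]
          n_def[symmetric] inter[symmetric])
  qed (simp_all add: eccentricity_matrix_def matrix_on_def es_def n_def)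
  then have "eccentricity_energy ?L = spectral_energy ?M"
    by (simp add: eccentricity_energy_def spectral_energy_def)
  also have "\<dots> = 4 * real p * (real r - 1) + 4 * (1 - 2 * real r)"
    by (rule spectral_energy_incidence[OF A _ gram rows cols ev r assms(5)]) (simp add: Aij)
  finally show ?thesis .
qed

end
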